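(* Let $n\ge 1$ and let $m=p_1^{r_1}\cdots p_l^{r_l}$, where $p_1,\dots,p_l$ are distinct primes and the $r_k$ are positive integers. Then $$f(\underbrace{1,\dots,1}_{n-1},m)=\left(\frac{m}{r(m)}\right)^{n-1}\sigma_1\!\left(r(m)^{n-1}\right),$$ where $r(m)=p_1\cdots p_l$ is the radical of $m$ and $\sigma_1(k)=\sum_{0<d\mid k}d$ is the sum of all positive divisors of an integer $k$.
   Context: An $n$-dimensional lattice is the $\mathbb{Z}$-span of $n$ linearly independent vectors in a Euclidean space; a sublattice of $\Lambda$ is a subset of $\Lambda$ which is itself an $n$-dimensional lattice. The invariant factors of a sublattice $\Lambda^*$ of $\Lambda$ are the diagonal entries $d_1\mid\cdots\mid d_n$ (positive integers) of the Smith normal form of the integer matrix expressing a basis of $\Lambda^*$ in a basis of $\Lambda$; they do not depend on the choices of bases. $f(d_1,\dots,d_n)$ is the number of sublattices of an $n$-dimensional lattice $\Lambda$ with invariant factors $d_1,\dots,d_n$ (this does not depend on $\Lambda$). In particular $f(1,\dots,1,m)$ (with $n-1$ ones) is the number of co-cyclic sublattices of index $m$, where $\Lambda^*$ is called co-cyclic if $\Lambda/\Lambda^*$ is a finite cyclic group. *)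

theory Defs
  imports "HOL-Analysis.Euclidean_Space" "HOL-Computational_Algebra.Primes"
    "Jordan_Normal_Form.Matrix"
begin

text \<open>Bases are ordered, hence lists. The dimension of the ambient Euclidean space may exceed that
  of the lattice.\<close>

definition lattice_basis :: "'a::euclidean_space list \<Rightarrow> 'a set \<Rightarrow> bool" where
  "lattice_basis bs L \<longleftrightarrow>
     distinct bs \<and> independent (set bs) \<and>
     L = {(\<Sum>i<length bs. of_int (c i) *\<^sub>R bs ! i) | c :: nat \<Rightarrow> int. True}"

definition euclidean_lattice :: "nat \<Rightarrow> 'a::euclidean_space set \<Rightarrow> bool" where
  "euclidean_lattice n L \<longleftrightarrow> (\<exists>bs. length bs = n \<and> lattice_basis bs L)"

definition sublattice :: "nat \<Rightarrow> 'a::euclidean_space set \<Rightarrow> 'a set \<Rightarrow> bool" where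
  "sublattice n M L \<longleftrightarrow> M \<subseteq> L \<and> euclidean_lattice n M"

text \<open>Column \<open>j\<close> of \<open>A\<close> holds the coordinates of \<open>cs ! j\<close> with respect to \<open>bs\<close>.\<close>

definition expresses_in_basis ::
    "int mat \<Rightarrow> 'a::euclidean_space list \<Rightarrow> 'a list \<Rightarrow> bool" where
  "expresses_in_basis A cs bs \<longleftrightarrow>
     A \<in> carrier_mat (length bs) (length cs) \<and>
     (\<forall>j<length cs. cs ! j = (\<Sum>i<length bs. of_int (A $$ (i, j)) *\<^sub>R bs ! i))"

definition smith_normal_form_of :: "nat \<Rightarrow> int mat \<Rightarrow> int mat \<Rightarrow> bool" where
  "smith_normal_form_of n A D \<longleftrightarrow>
     A \<in> carrier_mat n n \<and> D \<in> carrier_mat n n \<and> diagonal_mat D \<and>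
     (\<forall>i<n. 0 \<le> D $$ (i, i)) \<and>
     (\<forall>i. Suc i < n \<longrightarrow> D $$ (i, i) dvd D $$ (Suc i, Suc i)) \<and>
     (\<exists>P Q. P \<in> carrier_mat n n \<and> Q \<in> carrier_mat n n \<and>
        invertible_mat P \<and> invertible_mat Q \<and> D = P * A * Q)"

text \<open>The Smith normal form does not depend on the bases chosen below, so the existential
  quantifier over them is equivalent to a universal one. Since \<open>M\<close> has full rank \<open>n\<close>,
  the diagonal entries are automatically positive.\<close>

definition has_invariant_factors ::
    "nat \<Rightarrow> 'a::euclidean_space set \<Rightarrow> 'a set \<Rightarrow> nat list \<Rightarrow> bool" where
  "has_invariant_factors n M L ds \<longleftrightarrow>
     (\<exists>bs cs A D. length bs = n \<and> length cs = n \<and> lattice_basis bs L \<and> lattice_basis cs M \<and>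
        expresses_in_basis A cs bs \<and> smith_normal_form_of n A D \<and> diag_mat D = map int ds)"

definition sublattice_count :: "'a::euclidean_space set \<Rightarrow> nat list \<Rightarrow> nat" where
  "sublattice_count L ds =
     card {M. sublattice (length ds) M L \<and> has_invariant_factors (length ds) M L ds}"

definition divisor_sum :: "nat \<Rightarrow> nat" where
  "divisor_sum k = (\<Sum>d | 0 < d \<and> d dvd k. d)"

end

theory Submission
  imports Defs "HOL-Number_Theory.Totient"
begin

text \<open>
  A sublattice with invariant factors \<open>1, \<dots>, 1, m\<close> is the kernel of a surjective homomorphism from the
  lattice onto \<open>\<int>/m\<int>\<close>. After a basis of the lattice is fixed, such homomorphisms are the vectors \<open>a\<close> in
  \<open>{0..<m}\<^sup>n\<close> that are primitive modulo \<open>m\<close>, and \<open>a\<close> gives the sublattice of all points whose coordinates \<open>c\<close>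
  satisfy \<open>m dvd (\<Sum>i<n. a i * c i)\<close>. One direction reads the vector off the Smith normal form
  \<open>D = P * A * Q\<close>, as the last row of \<open>P\<close> (\<open>cocyclic_is_congruence_sublattice\<close>); the other one changes the
  basis until the form depends on the last coordinate only (\<open>congruence_sublattice_is_cocyclic\<close>).

  Two surjections onto \<open>\<int>/m\<int>\<close> have the same kernel iff they differ by a unit, so each sublattice
  comes from exactly \<open>totient m\<close> vectors (\<open>card_congruence_sublattice_fibre\<close>), and the number of sublattices is
  \<open>J\<^sub>n(m) / totient m\<close>, where Jordan's totient \<open>J\<^sub>n(m)\<close> counts the primitive vectors
  (\<open>sublattice_count_cocyclic\<close>).

  The Chinese remainder theorem makes \<open>J\<^sub>n\<close> multiplicative. At a prime power, removing the vectors that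
  are divisible by \<open>p\<close> gives \<open>J\<^sub>n(p ^ r) = p ^ (r * n) - p ^ ((r - 1) * n)\<close>, and dividing by
  \<open>totient (p ^ r) = p ^ (r - 1) * (p - 1)\<close> leaves
  \<open>(p ^ (r - 1)) ^ (n - 1) * (1 + p + \<dots> + p ^ (n - 1))\<close>, the asserted value for \<open>m = p ^ r\<close>. The claimed
  formula is multiplicative as well (\<open>jordan_totient_eq\<close>).
\<close>

section \<open>Vectors that are primitive modulo \<open>m\<close>\<close>

text \<open>Primitivity is phrased through a witness for the linear form \<open>a\<close> taking the value 1, rather
  than through a gcd: this is surjectivity of the homomorphism \<open>c \<mapsto> \<Sum>i<n. a i * c i\<close> onto
  \<open>\<int>/m\<int>\<close>, the form in which it arises from sublattices, and it passes through the Chinese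
  remainder theorem coordinate by coordinate.\<close>

definition primitive_mod :: "nat \<Rightarrow> int \<Rightarrow> (nat \<Rightarrow> int) \<Rightarrow> bool" where
  "primitive_mod n m a \<longleftrightarrow> (\<exists>c. [(\<Sum>i<n. a i * c i) = 1] (mod m))"

definition primitive_vectors :: "nat \<Rightarrow> int \<Rightarrow> (nat \<Rightarrow> int) set" where
  "primitive_vectors n m = {a \<in> {..<n} \<rightarrow>\<^sub>E {0..<m}. primitive_mod n m a}"

text \<open>This is Jordan's totient \<open>J\<^sub>n(m)\<close>, equal to \<open>totient m\<close> for \<open>n = 1\<close>.\<close>

definition jordan_totient :: "nat \<Rightarrow> nat \<Rightarrow> nat" where
  "jordan_totient n m = card (primitive_vectors n (int m))"

lemma finite_primitive_vectors [simp]: "finite (primitive_vectors n m)"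
  unfolding primitive_vectors_def by (auto intro!: finite_PiE)

lemma primitive_mod_cong:
  assumes "\<And>i. i < n \<Longrightarrow> [a i = b i] (mod m)"
  shows "primitive_mod n m a \<longleftrightarrow> primitive_mod n m b"
proof -
  have "[(\<Sum>i<n. a i * c i) = (\<Sum>i<n. b i * c i)] (mod m)" for c
    by (intro cong_sum cong_mult assms) auto
  then have "[(\<Sum>i<n. a i * c i) = 1] (mod m) \<longleftrightarrow> [(\<Sum>i<n. b i * c i) = 1] (mod m)" for c
    using cong_sym cong_trans by blast
  then show ?thesis by (simp only: primitive_mod_def)
qed

text \<open>A common witness modulo \<open>k * m\<close> is glued from the two given ones coordinatewise.\<close>

lemma primitive_mod_mult:
  assumes "coprime k m"
  shows "primitive_mod n (k * m) a \<longleftrightarrow> primitive_mod n k a \<and> primitive_mod n m a"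
proof
  assume "primitive_mod n (k * m) a"
  then show "primitive_mod n k a \<and> primitive_mod n m a"
    unfolding primitive_mod_def by (meson cong_modulus_mult cong_dvd_modulus dvd_triv_left dvd_triv_right)
next
  assume "primitive_mod n k a \<and> primitive_mod n m a"
  then obtain c d where c: "[(\<Sum>i<n. a i * c i) = 1] (mod k)" and d: "[(\<Sum>i<n. a i * d i) = 1] (mod m)"
    unfolding primitive_mod_def by blast
  have "\<exists>e. \<forall>i. [e i = c i] (mod k) \<and> [e i = d i] (mod m)"
    using binary_chinese_remainder_int[OF assms] by (intro choice) blast
  then obtain e where e: "\<And>i. [e i = c i] (mod k)" "\<And>i. [e i = d i] (mod m)" by blast
  have "[(\<Sum>i<n. a i * e i) = 1] (mod k)"
    by (rule cong_trans[OF _ c]) (intro cong_sum cong_mult e cong_refl)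
  moreover have "[(\<Sum>i<n. a i * e i) = 1] (mod m)"
    by (rule cong_trans[OF _ d]) (intro cong_sum cong_mult e cong_refl)
  ultimately show "primitive_mod n (k * m) a"
    unfolding primitive_mod_def using coprime_cong_mult assms by blast
qed

text \<open>A coordinate prime to \<open>p\<close> is already a unit modulo \<open>p ^ k\<close>, so one coordinate supplies the
  witness; if all coordinates were divisible by \<open>p\<close>, then so would be 1.\<close>

lemma primitive_mod_prime_power:
  assumes "prime (p :: int)" "k > 0"
  shows "primitive_mod n (p ^ k) a \<longleftrightarrow> (\<exists>i<n. \<not> p dvd a i)"
proof
  assume "primitive_mod n (p ^ k) a"
  then obtain c where "[(\<Sum>i<n. a i * c i) = 1] (mod p ^ k)" unfolding primitive_mod_def by blast
  then have c: "[(\<Sum>i<n. a i * c i) = 1] (mod p)"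
    using \<open>k > 0\<close> by (meson cong_dvd_modulus dvd_power)
  show "\<exists>i<n. \<not> p dvd a i"
  proof (rule ccontr)
    assume "\<not> ?thesis"
    then have "p dvd (\<Sum>i<n. a i * c i)" by (auto intro!: dvd_sum dvd_mult2)
    then show False using c assms(1) by (meson cong_dvd_iff cong_sym not_prime_unit)
  qed
next
  assume "\<exists>i<n. \<not> p dvd a i"
  then obtain i where i: "i < n" "\<not> p dvd a i" by blast
  then have "coprime (a i) (p ^ k)"
    using assms(1) by (simp add: coprime_commute prime_imp_coprime)
  then obtain x where "[a i * x = 1] (mod p ^ k)" using cong_solve_coprime_int by blast
  moreover have "(\<Sum>j<n. a j * (if j = i then x else 0)) = a i * x"
    using i(1) by (simp add: if_distrib cong: if_cong)
  ultimately have "[(\<Sum>j<n. a j * (if j = i then x else 0)) = 1] (mod p ^ k)" by (simp only:)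
  then show "primitive_mod n (p ^ k) a"
    unfolding primitive_mod_def by (intro exI[of _ "\<lambda>j. if j = i then x else 0"])
qed

section \<open>Jordan's totient and the divisor sum\<close>

text \<open>Reduction of the coordinates modulo \<open>k\<close> and modulo \<open>m\<close> is a bijection by the Chinese remainder
  theorem.\<close>

lemma jordan_totient_mult_coprime:
  assumes "coprime k m" "k > 0" "m > 0"
  shows "jordan_totient n (k * m) = jordan_totient n k * jordan_totient n m"
proof -
  let ?K = "int k" and ?M = "int m"
  let ?red = "\<lambda>q a. (\<lambda>i\<in>{..<n}. a i mod q) :: nat \<Rightarrow> int"
  let ?f = "\<lambda>a. (?red ?K a, ?red ?M a)"
  have cop: "coprime ?K ?M" using assms(1) by simp
  have red: "primitive_mod n q (?red q a) \<longleftrightarrow> primitive_mod n q a" for q a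
    by (rule primitive_mod_cong) simp
  have "bij_betw ?f (primitive_vectors n (?K * ?M)) (primitive_vectors n ?K \<times> primitive_vectors n ?M)"
    unfolding bij_betw_def
  proof
    show "inj_on ?f (primitive_vectors n (?K * ?M))"
    proof (rule inj_onI)
      fix a b assume a: "a \<in> primitive_vectors n (?K * ?M)" and b: "b \<in> primitive_vectors n (?K * ?M)"
        and eq: "?f a = ?f b"
      show "a = b"
      proof (rule PiE_ext)
        show "a \<in> {..<n} \<rightarrow>\<^sub>E {0..<?K * ?M}" "b \<in> {..<n} \<rightarrow>\<^sub>E {0..<?K * ?M}"
          using a b by (auto simp: primitive_vectors_def)
        fix i assume i: "i \<in> {..<n}"
        have "?red ?K a = ?red ?K b" "?red ?M a = ?red ?M b"
          using eq by (simp_all only: prod.inject)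
        from this[THEN fun_cong, of i] have "[a i = b i] (mod ?K)" "[a i = b i] (mod ?M)"
          using i by (simp_all add: cong_def)
        then have "[a i = b i] (mod ?K * ?M)" using cop by (rule coprime_cong_mult)
        moreover have "a i \<in> {0..<?K * ?M}" "b i \<in> {0..<?K * ?M}"
          using a b i unfolding primitive_vectors_def by blast+
        ultimately show "a i = b i" by (simp add: cong_def)
      qed
    qed
    show "?f ` primitive_vectors n (?K * ?M) = primitive_vectors n ?K \<times> primitive_vectors n ?M"
    proof safe
      fix a assume "a \<in> primitive_vectors n (?K * ?M)"
      then show "?red ?K a \<in> primitive_vectors n ?K" "?red ?M a \<in> primitive_vectors n ?M"
        using assms(2,3) red primitive_mod_mult[OF cop]
        by (auto simp: primitive_vectors_def)
    next
      fix b c assume b: "b \<in> primitive_vectors n ?K" and c: "c \<in> primitive_vectors n ?M"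
      have "\<exists>e. \<forall>i. [e i = b i] (mod ?K) \<and> [e i = c i] (mod ?M)"
        using binary_chinese_remainder_int[OF cop] by (intro choice) blast
      then obtain e where e: "\<And>i. [e i = b i] (mod ?K)" "\<And>i. [e i = c i] (mod ?M)" by blast
      let ?a = "?red (?K * ?M) e"
      have a: "[?a i = b i] (mod ?K)" "[?a i = c i] (mod ?M)" if "i < n" for i
        using e[of i] that by (auto simp: cong_def mod_mod_cancel)
      have "?a \<in> primitive_vectors n (?K * ?M)"
        using assms(2,3) b c primitive_mod_mult[OF cop] primitive_mod_cong[of n ?a b ?K] primitive_mod_cong[of n ?a c ?M] a
        by (auto simp: primitive_vectors_def)
      moreover have "?red ?K ?a = b"
      proof (rule PiE_ext)
        show "?red ?K ?a \<in> {..<n} \<rightarrow>\<^sub>E {0..<?K}" "b \<in> {..<n} \<rightarrow>\<^sub>E {0..<?K}"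
          using b assms(2) by (auto simp: primitive_vectors_def)
        fix i assume "i \<in> {..<n}"
        then show "?red ?K ?a i = b i" using a(1)[of i] b by (auto simp: primitive_vectors_def cong_def PiE_iff)
      qed
      moreover have "?red ?M ?a = c"
      proof (rule PiE_ext)
        show "?red ?M ?a \<in> {..<n} \<rightarrow>\<^sub>E {0..<?M}" "c \<in> {..<n} \<rightarrow>\<^sub>E {0..<?M}"
          using c assms(3) by (auto simp: primitive_vectors_def)
        fix i assume "i \<in> {..<n}"
        then show "?red ?M ?a i = c i" using a(2)[of i] c by (auto simp: primitive_vectors_def cong_def PiE_iff)
      qed
      ultimately show "(b, c) \<in> ?f ` primitive_vectors n (?K * ?M)"
        by (intro image_eqI[of _ _ ?a]) (simp_all only:)
    qed
  qed
  from bij_betw_same_card[OF this] show ?thesis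
    by (simp add: jordan_totient_def card_cartesian_product)
qed

lemma card_multiples_below:
  assumes "p > 0"
  shows "card {x \<in> {0..<int p * int q}. int p dvd x} = q"
proof -
  have "{x \<in> {0..<int p * int q}. int p dvd x} = (\<lambda>y. int p * int y) ` {..<q}" (is "?A = ?B")
  proof (intro equalityI subsetI)
    fix x assume "x \<in> ?A"
    then obtain z where z: "x = int p * z" "0 \<le> int p * z" "int p * z < int p * int q"
      by (auto elim!: dvdE)
    have "0 \<le> z" using z(2) assms by (simp add: zero_le_mult_iff)
    moreover have "z < int q" using z(3) assms by simp
    ultimately show "x \<in> ?B" using z(1) by (intro image_eqI[of _ _ "nat z"]) simp_all
  next
    fix x assume "x \<in> ?B"
    then obtain y where y: "x = int p * int y" "y < q" by blast
    have "int p * int y < int p * int q" using y(2) assms by (intro mult_strict_left_mono) simp_all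
    then show "x \<in> ?A" using y(1) by simp
  qed
  moreover have "inj_on (\<lambda>y. int p * int y) {..<q}" using assms by (auto intro: inj_onI)
  ultimately show ?thesis by (simp add: card_image)
qed

text \<open>The vectors that fail to be primitive are those with all coordinates among the \<open>p ^ k\<close> multiples
  of \<open>p\<close> below \<open>p ^ Suc k\<close>.\<close>

lemma jordan_totient_prime_power:
  assumes "prime p"
  shows "jordan_totient n (p ^ Suc k) = (p ^ Suc k) ^ n - (p ^ k) ^ n"
proof -
  let ?A = "{..<n} \<rightarrow>\<^sub>E {0..<int (p ^ Suc k)}"
  let ?B = "{..<n} \<rightarrow>\<^sub>E {x \<in> {0..<int (p ^ Suc k)}. int p dvd x}"
  have "primitive_vectors n (int (p ^ Suc k)) = ?A - ?B"
    using primitive_mod_prime_power[of "int p" "Suc k" n] assms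
    by (auto simp: primitive_vectors_def PiE_iff extensional_def simp del: power_Suc)
  moreover have sub: "?B \<subseteq> ?A" by (rule PiE_mono) auto
  moreover have "finite ?B" by (rule finite_subset[OF sub]) (simp add: finite_PiE)
  moreover have "card ?A = (p ^ Suc k) ^ n" by (simp add: card_PiE nat_power_eq del: power_Suc)
  moreover have "card ?B = (p ^ k) ^ n"
    using card_multiples_below[of p "p ^ k"] prime_gt_0_nat[OF assms] by (simp add: card_PiE)
  ultimately show ?thesis by (simp add: jordan_totient_def card_Diff_subset)
qed

lemma divisor_sum_prime_power:
  assumes "prime p"
  shows "divisor_sum (p ^ k) = (\<Sum>i\<le>k. p ^ i)"
proof -
  have "{d. 0 < d \<and> d dvd p ^ k} = (\<lambda>i. p ^ i) ` {..k}"
    using divides_primepow_nat[OF assms, of _ k] prime_gt_0_nat[OF assms] by auto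
  moreover have "inj_on (\<lambda>i. p ^ i) {..k}"
    using prime_gt_1_nat[OF assms] by (auto intro: inj_onI)
  ultimately show ?thesis by (simp add: divisor_sum_def sum.reindex)
qed

lemma divisor_sum_mult_coprime:
  assumes "coprime a b" "a > 0" "b > 0"
  shows "divisor_sum (a * b) = divisor_sum a * divisor_sum b"
proof -
  let ?D = "\<lambda>k::nat. {d. 0 < d \<and> d dvd k}"
  have "bij_betw (\<lambda>(x, y). x * y) (?D a \<times> ?D b) (?D (a * b))"
    unfolding bij_betw_def
  proof
    show "inj_on (\<lambda>(x, y). x * y) (?D a \<times> ?D b)"
    proof (rule inj_onI, clarify)
      fix x y x' y' assume d: "x dvd a" "y dvd b" "x' dvd a" "y' dvd b" and eq: "x * y = x' * y'"
      have "coprime x y'" "coprime y x'"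
        using d assms(1) by (meson coprime_commute coprime_divisors)+
      then show "x = x' \<and> y = y'" using eq coprime_crossproduct_nat[of x y' x' y]
        by (simp add: coprime_commute mult.commute)
    qed
    show "(\<lambda>(x, y). x * y) ` (?D a \<times> ?D b) = ?D (a * b)"
    proof safe
      fix d assume "d dvd a * b" "0 < d"
      then show "d \<in> (\<lambda>(x, y). x * y) ` (?D a \<times> ?D b)"
        using division_decomp[of d a b] by force
    qed (auto intro: mult_dvd_mono)
  qed
  from sum.reindex_bij_betw[OF this, of "\<lambda>d. d"]
  show ?thesis by (simp add: divisor_sum_def sum_product sum.cartesian_product case_prod_unfold)
qed

text \<open>Both sides are multiplicative in \<open>m\<close>, so the identity is checked at a single prime power, where
  \<open>J\<^sub>n(p ^ Suc s) = (p ^ s) ^ n * (p ^ n - 1)\<close> and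
  \<open>p ^ n - 1 = (p - 1) * (1 + p + \<dots> + p ^ (n - 1))\<close>: the factor \<open>p - 1\<close> goes into the totient and the
  geometric sum is the divisor sum of \<open>p ^ (n - 1)\<close>.\<close>

lemma jordan_totient_eq:
  fixes p r :: "nat \<Rightarrow> nat"
  assumes "finite K" "n \<ge> 1" "inj_on p K" "\<And>k. k \<in> K \<Longrightarrow> prime (p k)" "\<And>k. k \<in> K \<Longrightarrow> r k > 0"
  shows "jordan_totient n (\<Prod>k\<in>K. p k ^ r k) =
    totient (\<Prod>k\<in>K. p k ^ r k) * ((\<Prod>k\<in>K. p k ^ (r k - 1)) ^ (n - 1) * divisor_sum ((\<Prod>k\<in>K. p k) ^ (n - 1)))"
  using assms(1,3-5)
proof (induction K rule: finite_induct)
  case empty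
  have "{..<n} \<rightarrow>\<^sub>E {0..<1::int} = {\<lambda>i\<in>{..<n}. 0}"
  proof -
    have "{0..<1::int} = {0}" by auto
    then show ?thesis by (simp add: PiE_singleton restrict_def)
  qed
  then have "primitive_vectors n 1 = {\<lambda>i\<in>{..<n}. 0}"
    unfolding primitive_vectors_def primitive_mod_def by auto
  moreover have "{d::nat. 0 < d \<and> d dvd 1} = {1}" by auto
  ultimately show ?case by (simp add: jordan_totient_def divisor_sum_def)
next
  case (insert x K)
  let ?P = "\<lambda>s. \<Prod>k\<in>K. p k ^ s k"
  have px: "prime (p x)" and rx: "r x > 0" using insert.prems by auto
  obtain s where s: "r x = Suc s" using rx gr0_conv_Suc by auto
  have cop: "coprime (p x) (p k)" if "k \<in> K" for k
    using that insert.prems insert.hyps by (intro primes_coprime) (auto simp: inj_on_def)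
  have cop1: "coprime (p x ^ r x) (\<Prod>k\<in>K. p k ^ r k)" by (intro prod_coprime_right) (simp add: cop)
  have cop2: "coprime (p x ^ (n-1)) ((\<Prod>k\<in>K. p k) ^ (n-1))"
    by (simp add: cop prod_coprime_right)
  have pos: "p k > 0" if "k \<in> insert x K" for k using insert.prems that prime_gt_0_nat by blast
  have pos1: "(\<Prod>k\<in>K. p k ^ r k) > 0" "(\<Prod>k\<in>K. p k) ^ (n-1) > 0" "p x ^ r x > 0" "p x ^ (n-1) > 0"
    using pos by (auto intro!: prod_pos)
  have IH: "jordan_totient n (\<Prod>k\<in>K. p k ^ r k) =
    totient (\<Prod>k\<in>K. p k ^ r k) * ((\<Prod>k\<in>K. p k ^ (r k - 1)) ^ (n - 1) * divisor_sum ((\<Prod>k\<in>K. p k) ^ (n - 1)))"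
    using insert.prems by (intro insert.IH) auto
  have geo: "p x ^ n - 1 = (p x - 1) * (\<Sum>i\<le>n-1. p x ^ i)"
  proof -
    have "{..n-1} = {..<n}" using assms(2) by auto
    then have "int (p x ^ n - 1) = int ((p x - 1) * (\<Sum>i\<le>n-1. p x ^ i))"
      using power_diff_1_eq[of "int (p x)" n] pos[of x] by (simp add: of_nat_diff)
    then show ?thesis by linarith
  qed
  obtain n' where n': "n = Suc n'" using assms(2) by (cases n) auto
  have "jordan_totient n (p x ^ r x) = (p x ^ s) ^ n * (p x ^ n - 1)"
    using jordan_totient_prime_power[OF px, of n s]
    by (simp add: s diff_mult_distrib2 power_mult_distrib mult.commute)
  also have "\<dots> = totient (p x ^ r x) * ((p x ^ (r x - 1)) ^ (n - 1) * divisor_sum (p x ^ (n-1)))"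
    unfolding geo totient_prime_power[OF px rx] divisor_sum_prime_power[OF px] by (simp add: s n')
  finally have loc: "jordan_totient n (p x ^ r x) =
      totient (p x ^ r x) * ((p x ^ (r x - 1)) ^ (n - 1) * divisor_sum (p x ^ (n-1)))" .
  show ?case
    using insert.hyps
    by (simp del: One_nat_def add: jordan_totient_mult_coprime[OF cop1 pos1(3,1)] totient_mult_coprime[OF cop1]
        power_mult_distrib divisor_sum_mult_coprime[OF cop2 pos1(4,2)] loc IH)
qed

section \<open>Lattice bases and integer coordinates\<close>

abbreviation int_comb :: "'a::euclidean_space list \<Rightarrow> (nat \<Rightarrow> int) \<Rightarrow> 'a" where
  "int_comb bs c \<equiv> (\<Sum>i<length bs. of_int (c i) *\<^sub>R bs ! i)"

text \<open>For a list, distinctness and independence of the underlying set together say that coefficients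
  indexed by positions are unique; all later arguments use bases only in this form.\<close>

lemma distinct_independent_iff:
  fixes bs :: "'a::euclidean_space list"
  shows "distinct bs \<and> independent (set bs) \<longleftrightarrow>
    (\<forall>c. (\<Sum>i<length bs. c i *\<^sub>R bs ! i) = 0 \<longrightarrow> (\<forall>i<length bs. c i = 0))"
  (is "?L \<longleftrightarrow> ?R")
proof
  assume L: ?L
  then have bij: "bij_betw ((!) bs) {..<length bs} (set bs)" by (intro bij_betw_nth) auto
  show ?R
  proof (intro allI impI)
    fix c i assume z: "(\<Sum>i<length bs. c i *\<^sub>R bs ! i) = 0" and i: "i < length bs"
    let ?g = "inv_into {..<length bs} ((!) bs)"
    have g: "?g (bs ! j) = j" if "j < length bs" for j
      using bij that by (simp add: bij_betw_def inv_into_f_f)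
    have "(\<Sum>v\<in>set bs. c (?g v) *\<^sub>R v) = (\<Sum>i<length bs. c i *\<^sub>R bs ! i)"
      by (subst sum.reindex_bij_betw[OF bij, symmetric]) (intro sum.cong refl, simp add: g)
    then have "(\<Sum>v\<in>set bs. c (?g v) *\<^sub>R v) = 0" using z by simp
    then have "\<forall>v\<in>set bs. c (?g v) = 0"
      using L[THEN conjunct2, unfolded independent_explicit, THEN conjunct2, THEN spec, of "\<lambda>v. c (?g v)"] by blast
    then have "c (?g (bs ! i)) = 0" using nth_mem[OF i] by blast
    then show "c i = 0" by (simp only: g[OF i])
  qed
next
  assume R: ?R
  have d: "distinct bs"
  proof (rule ccontr)
    assume "\<not> distinct bs"
    then obtain i j where ij: "i < length bs" "j < length bs" "i \<noteq> j" "bs ! i = bs ! j"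
      by (auto simp: distinct_conv_nth)
    let ?c = "\<lambda>l. (if l = i then 1 else 0) - (if l = j then 1 else 0) :: real"
    have "(\<Sum>l<length bs. ?c l *\<^sub>R bs ! l) = 0"
      using ij by (simp add: scaleR_left_diff_distrib sum_subtractf if_distrib[of "\<lambda>t. t *\<^sub>R _"] cong: if_cong)
    with R[THEN spec, of ?c] ij(1) have "?c i = 0" by blast
    then show False using ij(3) by simp
  qed
  moreover have "independent (set bs)"
    unfolding independent_explicit
  proof (intro conjI allI impI ballI)
    fix u v assume z: "(\<Sum>v\<in>set bs. u v *\<^sub>R v) = 0" and v: "v \<in> set bs"
    have "(\<Sum>i<length bs. u (bs ! i) *\<^sub>R bs ! i) = 0"
      using sum.reindex_bij_betw[OF bij_betw_nth[OF d refl refl], of "\<lambda>v. u v *\<^sub>R v"] z by simp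
    with R[THEN spec, of "\<lambda>i. u (bs ! i)"] have u: "\<forall>i<length bs. u (bs ! i) = 0" by blast
    from v obtain i where "i < length bs" "bs ! i = v" unfolding in_set_conv_nth by blast
    then show "u v = 0" using u by blast
  qed simp
  ultimately show ?L by blast
qed

lemma lattice_basis_iff:
  "lattice_basis bs L \<longleftrightarrow>
    (\<forall>c. (\<Sum>i<length bs. c i *\<^sub>R bs ! i) = 0 \<longrightarrow> (\<forall>i<length bs. c i = 0)) \<and> L = range (int_comb bs)"
  unfolding lattice_basis_def conj_assoc[symmetric] distinct_independent_iff by (auto simp: full_SetCompr_eq)

lemma lattice_basis_range: "lattice_basis bs L \<Longrightarrow> L = range (int_comb bs)"
  unfolding lattice_basis_iff by blast

lemma lattice_basis_coeff_zero:
  assumes "lattice_basis bs L" "(\<Sum>i<length bs. c i *\<^sub>R bs ! i) = 0" "i < length bs"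
  shows "c i = 0"
proof -
  have "\<forall>c. (\<Sum>i<length bs. c i *\<^sub>R bs ! i) = 0 \<longrightarrow> (\<forall>i<length bs. c i = 0)"
    using assms(1) unfolding lattice_basis_iff by (rule conjunct1)
  from this[THEN spec, of c] show ?thesis using assms(2,3) by blast
qed

lemma int_comb_inject:
  assumes "lattice_basis bs L" "int_comb bs c = int_comb bs d" "i < length bs"
  shows "c i = d i"
proof -
  have "(\<Sum>i<length bs. (real_of_int (c i) - of_int (d i)) *\<^sub>R bs ! i) = 0"
    using assms(2) by (simp add: scaleR_left_diff_distrib sum_subtractf)
  from lattice_basis_coeff_zero[OF assms(1) this assms(3)] show ?thesis by simp
qed

section \<open>Sublattices cut out by one congruence\<close>

text \<open>In coordinates with respect to \<open>bs\<close>, this is the kernel modulo \<open>m\<close> of the integral linear form with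
  coefficients \<open>a\<close>.\<close>

definition congruence_sublattice :: "'a::euclidean_space list \<Rightarrow> int \<Rightarrow> (nat \<Rightarrow> int) \<Rightarrow> 'a set" where
  "congruence_sublattice bs m a = {int_comb bs c | c. m dvd (\<Sum>i<length bs. a i * c i)}"

lemma int_comb_in_congruence_sublattice_iff:
  assumes "lattice_basis bs L"
  shows "int_comb bs c \<in> congruence_sublattice bs m a \<longleftrightarrow> m dvd (\<Sum>i<length bs. a i * c i)"
proof
  assume "int_comb bs c \<in> congruence_sublattice bs m a"
  then obtain d where d: "int_comb bs c = int_comb bs d" "m dvd (\<Sum>i<length bs. a i * d i)"
    unfolding congruence_sublattice_def by blast
  have "(\<Sum>i<length bs. a i * c i) = (\<Sum>i<length bs. a i * d i)"
    by (intro sum.cong refl) (simp add: int_comb_inject[OF assms d(1)])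
  then show "m dvd (\<Sum>i<length bs. a i * c i)" using d(2) by simp
qed (auto simp: congruence_sublattice_def)

text \<open>Here \<open>E\<close> rewrites coordinates with respect to \<open>bs'\<close> into coordinates with respect to \<open>bs\<close>, and \<open>a'\<close>
  is the form \<open>a\<close> pulled back along \<open>E\<close>. Since both lists are bases of \<open>L\<close>, \<open>E\<close> is onto, so the two
  forms have the same kernel and the same values.\<close>

lemma congruence_sublattice_change_basis:
  assumes bs: "lattice_basis bs L" "length bs = n" and bs': "lattice_basis bs' L" "length bs' = n"
    and E: "\<And>c. int_comb bs' c = int_comb bs (E c)"
    and a': "\<And>c. (\<Sum>i<n. a' i * c i) = (\<Sum>i<n. a i * E c i)"
  shows "congruence_sublattice bs' m a' = congruence_sublattice bs m a"
    and "primitive_mod n m a' \<longleftrightarrow> primitive_mod n m a"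
proof -
  have surj: "\<exists>c. \<forall>i<n. d i = E c i" for d
  proof -
    have "int_comb bs d \<in> range (int_comb bs')"
      unfolding lattice_basis_range[OF bs'(1), symmetric] unfolding lattice_basis_range[OF bs(1)]
      by (rule rangeI)
    then obtain c where "int_comb bs d = int_comb bs' c" by blast
    then have "int_comb bs d = int_comb bs (E c)" by (simp only: E)
    from int_comb_inject[OF bs(1) this] show ?thesis unfolding bs(2) by blast
  qed
  have dot: "(\<Sum>i<n. a i * d i) = (\<Sum>i<n. a' i * c i)" if "\<forall>i<n. d i = E c i" for c d
    unfolding a' using that by (intro sum.cong) auto
  show "congruence_sublattice bs' m a' = congruence_sublattice bs m a"
  proof (intro equalityI subsetI)
    fix x assume "x \<in> congruence_sublattice bs m a"
    then obtain d where d: "x = int_comb bs d" "m dvd (\<Sum>i<n. a i * d i)"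
      unfolding congruence_sublattice_def bs(2) by blast
    obtain c where c: "\<forall>i<n. d i = E c i" using surj by blast
    have "x = int_comb bs' c" unfolding d(1) E using c bs(2) by (intro sum.cong) auto
    then show "x \<in> congruence_sublattice bs' m a'"
      using d(2) dot[OF c] bs'(2) unfolding congruence_sublattice_def by auto
  qed (use E a' bs(2) bs'(2) in \<open>auto simp: congruence_sublattice_def\<close>)
  show "primitive_mod n m a' \<longleftrightarrow> primitive_mod n m a"
  proof
    assume "primitive_mod n m a'"
    then show "primitive_mod n m a" unfolding primitive_mod_def a' by blast
  next
    assume "primitive_mod n m a"
    then obtain d where d: "[(\<Sum>i<n. a i * d i) = 1] (mod m)" unfolding primitive_mod_def by blast
    obtain c where "\<forall>i<n. d i = E c i" using surj by blast
    from d[unfolded dot[OF this]] show "primitive_mod n m a'" unfolding primitive_mod_def by blast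
  qed
qed

lemma congruence_sublattice_any_basis:
  assumes bs: "lattice_basis bs L" "length bs = n" and bs': "lattice_basis bs' L" "length bs' = n"
    and "primitive_mod n m a"
  obtains a' where "congruence_sublattice bs' m a' = congruence_sublattice bs m a" "primitive_mod n m a'"
proof -
  have "\<exists>t. bs' ! i = int_comb bs t" if "i < n" for i
  proof -
    have "int_comb bs' (\<lambda>l. if l = i then 1 else 0) = (\<Sum>l<n. if l = i then bs' ! l else 0)"
      unfolding bs'(2) by (intro sum.cong refl) simp
    also have "\<dots> = bs' ! i" using that by simp
    finally have "bs' ! i \<in> range (int_comb bs')" by (intro range_eqI) (rule sym)
    then have "bs' ! i \<in> range (int_comb bs)"
      by (simp only: lattice_basis_range[OF bs'(1), symmetric] lattice_basis_range[OF bs(1), symmetric])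
    then show ?thesis by blast
  qed
  then have "\<forall>i. \<exists>t. i < n \<longrightarrow> bs' ! i = int_comb bs t" by blast
  from choice[OF this] obtain T where T: "\<And>i. i < n \<Longrightarrow> bs' ! i = int_comb bs (T i)" by blast
  let ?E = "\<lambda>c j. \<Sum>i<n. c i * T i j"
  have "int_comb bs' c = int_comb bs (?E c)" for c
  proof -
    have "int_comb bs' c = (\<Sum>i<n. \<Sum>j<n. of_int (c i * T i j) *\<^sub>R bs ! j)"
      by (simp add: bs' bs T scaleR_sum_right)
    also have "\<dots> = int_comb bs (?E c)"
      by (subst sum.swap) (simp add: scaleR_sum_left bs)
    finally show ?thesis .
  qed
  moreover have "(\<Sum>i<n. (\<Sum>j<n. T i j * a j) * c i) = (\<Sum>j<n. a j * ?E c j)" for c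
    unfolding sum_distrib_left sum_distrib_right by (subst sum.swap) (simp add: mult_ac)
  ultimately show ?thesis
    using congruence_sublattice_change_basis[OF bs bs', of ?E "\<lambda>i. \<Sum>j<n. T i j * a j" a m] that assms(5) by blast
qed

section \<open>Elementary operations and adapted bases\<close>

text \<open>Adding \<open>k\<close> times basis vector \<open>j\<close> to basis vector \<open>i\<close> acts on coordinates by the transposed
  operation, from coordinate \<open>i\<close> to coordinate \<open>j\<close>. The same transposition for the coefficients of a
  linear form is the integer identity after this one.\<close>

lemma sum_scaleR_list_update:
  fixes bs :: "'a::real_vector list"
  assumes "i < length bs" "j < length bs"
  shows "(\<Sum>l<length bs. c l *\<^sub>R bs[i := bs ! i + k *\<^sub>R bs ! j] ! l) =
    (\<Sum>l<length bs. (c(j := c j + k * c i)) l *\<^sub>R bs ! l)"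
proof -
  have "(\<Sum>l<length bs. c l *\<^sub>R bs[i := bs ! i + k *\<^sub>R bs ! j] ! l) =
      (\<Sum>l<length bs. c l *\<^sub>R bs ! l + (if l = i then (c i * k) *\<^sub>R bs ! j else 0))"
    by (intro sum.cong refl) (auto simp: nth_list_update scaleR_right_distrib)
  also have "\<dots> = (\<Sum>l<length bs. c l *\<^sub>R bs ! l) + (c i * k) *\<^sub>R bs ! j"
    using assms by (simp add: sum.distrib)
  also have "\<dots> = (\<Sum>l<length bs. c l *\<^sub>R bs ! l + (if l = j then (c i * k) *\<^sub>R bs ! j else 0))"
    using assms by (simp add: sum.distrib)
  also have "\<dots> = (\<Sum>l<length bs. (c(j := c j + k * c i)) l *\<^sub>R bs ! l)"
    by (intro sum.cong refl) (auto simp: scaleR_left_distrib mult.commute)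
  finally show ?thesis .
qed

lemma sum_mult_fun_upd:
  fixes a c :: "nat \<Rightarrow> int"
  assumes "i < n" "j < n"
  shows "(\<Sum>l<n. (a(i := a i + k * a j)) l * c l) = (\<Sum>l<n. a l * (c(j := c j + k * c i)) l)"
proof -
  have "(\<Sum>l<n. (a(i := a i + k * a j)) l * c l) = (\<Sum>l<n. a l * c l + (if l = i then k * a j * c i else 0))"
    by (intro sum.cong refl) (auto simp: algebra_simps)
  also have "\<dots> = (\<Sum>l<n. a l * c l + (if l = j then k * a j * c i else 0))"
    using assms by (simp add: sum.distrib)
  also have "\<dots> = (\<Sum>l<n. a l * (c(j := c j + k * c i)) l)"
    by (intro sum.cong refl) (auto simp: algebra_simps)
  finally show ?thesis .
qed

lemma lattice_basis_elementary:
  assumes bs: "lattice_basis bs L" and ij: "i < length bs" "j < length bs" "i \<noteq> j"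
  shows "lattice_basis (bs[i := bs ! i + of_int k *\<^sub>R bs ! j]) L" (is "lattice_basis ?bs' L")
    and "int_comb (bs[i := bs ! i + of_int k *\<^sub>R bs ! j]) c = int_comb bs (c(j := c j + k * c i))"
proof -
  have comb: "int_comb ?bs' c = int_comb bs (c(j := c j + k * c i))" for c
    using sum_scaleR_list_update[OF ij(1,2), of "\<lambda>l. of_int (c l)" "of_int k"]
    by (simp add: fun_upd_def if_distrib[of real_of_int] cong: if_cong)
  show "int_comb ?bs' c = int_comb bs (c(j := c j + k * c i))" by (rule comb)
  show "lattice_basis ?bs' L"
    unfolding lattice_basis_iff
  proof (intro conjI allI impI)
    fix c l assume z: "(\<Sum>l<length ?bs'. c l *\<^sub>R ?bs' ! l) = 0" and l: "l < length ?bs'"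
    let ?d = "c(j := c j + of_int k * c i)"
    have "(\<Sum>l<length bs. ?d l *\<^sub>R bs ! l) = 0"
      using z sum_scaleR_list_update[OF ij(1,2), of c "of_int k"] by simp
    from lattice_basis_coeff_zero[OF bs this] have d: "?d l = 0" if "l < length bs" for l
      using that by blast
    have "c i = 0" using d[OF ij(1)] ij(3) by simp
    then show "c l = 0" using d[of l] l by (cases "l = j") simp_all
  next
    have L: "L = range (int_comb bs)" using bs by (rule lattice_basis_range)
    show "L = range (int_comb ?bs')"
    proof (intro equalityI subsetI)
      fix x assume "x \<in> L"
      then obtain c where c: "x = int_comb bs c" unfolding L by blast
      have "(c(j := c j - k * c i))(j := (c(j := c j - k * c i)) j + k * (c(j := c j - k * c i)) i) = c"
        using ij by auto
      then have "x = int_comb ?bs' (c(j := c j - k * c i))" unfolding comb c by (simp only:)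
      then show "x \<in> range (int_comb ?bs')" by blast
    next
      fix x assume "x \<in> range (int_comb ?bs')"
      then show "x \<in> L" unfolding L comb by blast
    qed
  qed
qed

lemma congruence_sublattice_elementary:
  assumes bs: "lattice_basis bs L" "length bs = n" and ij: "i < n" "j < n" "i \<noteq> j"
  shows "congruence_sublattice (bs[i := bs ! i + of_int k *\<^sub>R bs ! j]) m (a(i := a i + k * a j)) =
      congruence_sublattice bs m a"
    and "primitive_mod n m (a(i := a i + k * a j)) \<longleftrightarrow> primitive_mod n m a"
proof -
  note ij' = ij[folded bs(2)]
  note basis = lattice_basis_elementary(1)[OF bs(1) ij', of k]
  show "congruence_sublattice (bs[i := bs ! i + of_int k *\<^sub>R bs ! j]) m (a(i := a i + k * a j)) =
      congruence_sublattice bs m a"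
    by (rule congruence_sublattice_change_basis(1)[OF bs basis _ lattice_basis_elementary(2)[OF bs(1) ij']
          sum_mult_fun_upd[OF ij(1,2)]]) (simp add: bs)
  show "primitive_mod n m (a(i := a i + k * a j)) \<longleftrightarrow> primitive_mod n m a"
    by (rule congruence_sublattice_change_basis(2)[OF bs basis _ lattice_basis_elementary(2)[OF bs(1) ij']
          sum_mult_fun_upd[OF ij(1,2)]]) (simp add: bs)
qed

text \<open>Euclid's algorithm on the coefficients of the form, carried out by elementary operations on the
  basis. Instead of running it, a pair (basis, form) with least \<open>\<Sum>i<n. \<bar>a i\<bar>\<close> is chosen: two nonzero
  coefficients would allow one more reduction step, so at most one is left, and two further operations
  move it to the last position.\<close>

lemma congruence_sublattice_adapted_basis:
  assumes "lattice_basis bs L" "length bs = n" "primitive_mod n m a" "n \<ge> 1"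
  obtains bs' a' where "lattice_basis bs' L" "length bs' = n" "primitive_mod n m a'"
    "congruence_sublattice bs' m a' = congruence_sublattice bs m a" "\<And>i. i < n - 1 \<Longrightarrow> a' i = 0"
proof -
  let ?M = "congruence_sublattice bs m a"
  define S where "S = {(bs', a'). lattice_basis bs' L \<and> length bs' = n \<and> primitive_mod n m a' \<and>
    congruence_sublattice bs' m a' = ?M}"
  have step: "(bs'[i := bs' ! i + of_int k *\<^sub>R bs' ! j], a'(i := a' i + k * a' j)) \<in> S"
    if "(bs', a') \<in> S" "i < n" "j < n" "i \<noteq> j" for bs' a' i j k
    using that congruence_sublattice_elementary[of bs' L n i j] lattice_basis_elementary(1)[of bs' L i j]
    by (auto simp: S_def)
  let ?w = "\<lambda>x. \<Sum>i<n. nat \<bar>snd x i\<bar>"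
  have "(bs, a) \<in> S" using assms by (simp add: S_def)
  then obtain x where x: "x \<in> S" "\<And>y. y \<in> S \<Longrightarrow> ?w x \<le> ?w y"
    using ex_has_least_nat[of "\<lambda>x. x \<in> S" "(bs, a)" ?w] by blast
  obtain b1 a1 where x_eq: "x = (b1, a1)" by (cases x)
  have less: False if ij: "i < n" "j < n" "i \<noteq> j" "a1 i \<noteq> 0" "\<bar>a1 i\<bar> \<le> \<bar>a1 j\<bar>" for i j
  proof -
    \<comment> \<open>This sign makes the smaller coefficient cancel against the larger one.\<close>
    define k where "k = - (sgn (a1 i) * sgn (a1 j))"
    have dec: "\<bar>a1 j + k * a1 i\<bar> < \<bar>a1 j\<bar>"
      using ij(4,5) by (auto simp: k_def sgn_if)
    have "(b1[j := b1 ! j + of_int k *\<^sub>R b1 ! i], a1(j := a1 j + k * a1 i)) \<in> S"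
      using step[of b1 a1 j i] x(1) ij by (simp add: x_eq)
    from x(2)[OF this] have "(\<Sum>l<n. nat \<bar>a1 l\<bar>) \<le> (\<Sum>l<n. nat \<bar>(a1(j := a1 j + k * a1 i)) l\<bar>)"
      by (simp add: x_eq)
    moreover have "(\<Sum>l<n. nat \<bar>(a1(j := a1 j + k * a1 i)) l\<bar>) < (\<Sum>l<n. nat \<bar>a1 l\<bar>)"
      by (rule sum_strict_mono_ex1) (use dec ij(2) in \<open>auto intro!: bexI[of _ j]\<close>)
    ultimately show False by simp
  qed
  have single: "a1 i = 0 \<or> a1 j = 0" if "i < n" "j < n" "i \<noteq> j" for i j
    using less[of i j] less[of j i] that linear[of "\<bar>a1 i\<bar>" "\<bar>a1 j\<bar>"] by blast
  show ?thesis
  proof (cases "\<exists>i<n-1. a1 i \<noteq> 0")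
    case False
    then show ?thesis using that[of b1 a1] x(1) by (auto simp: x_eq S_def)
  next
    case True
    then obtain i where i: "i < n - 1" "a1 i \<noteq> 0" by blast
    have z: "a1 l = 0" if "l < n" "l \<noteq> i" for l using single[of l i] that i by auto
    let ?j = "n - 1"
    \<comment> \<open>The first operation copies the only nonzero coefficient to the last position, the second clears the original.\<close>
    define b2 a2 where 2: "b2 = b1[?j := b1 ! ?j + of_int 1 *\<^sub>R b1 ! i]" "a2 = a1(?j := a1 ?j + 1 * a1 i)"
    have S2: "(b2, a2) \<in> S"
      unfolding 2 by (rule step) (use x(1) i in \<open>auto simp: x_eq\<close>)
    define b3 a3 where 3: "b3 = b2[i := b2 ! i + of_int (-1) *\<^sub>R b2 ! ?j]" "a3 = a2(i := a2 i + (-1) * a2 ?j)"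
    have S3: "(b3, a3) \<in> S"
      unfolding 3 by (rule step[OF S2]) (use i in auto)
    have "a3 l = 0" if "l < n - 1" for l
      using that z[of l] z[of ?j] i by (auto simp: 3(2) 2(2))
    then show ?thesis using that[of b3 a3] S3 by (auto simp: S_def)
  qed
qed

section \<open>Co-cyclic sublattices are the kernels of primitive forms\<close>

lemma lattice_basis_scale_last:
  assumes bs: "lattice_basis bs L" "length bs = Suc k" and "m > 0"
  shows "lattice_basis (bs[k := real m *\<^sub>R bs ! k]) {int_comb bs c | c. int m dvd c k}"
    (is "lattice_basis ?cs _")
  unfolding lattice_basis_iff
proof (intro conjI allI impI)
  have scale: "(\<Sum>i<length ?cs. c i *\<^sub>R ?cs ! i) = (\<Sum>i<length bs. (c(k := real m * c k)) i *\<^sub>R bs ! i)" for c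
    using bs(2) by (auto intro!: sum.cong simp: nth_list_update)
  {
    fix c i assume z: "(\<Sum>i<length ?cs. c i *\<^sub>R ?cs ! i) = 0" and i: "i < length ?cs"
    have "(c(k := real m * c k)) i = 0"
      using lattice_basis_coeff_zero[OF bs(1) z[unfolded scale]] i by simp
    then show "c i = 0" using \<open>m > 0\<close> by (simp split: if_splits)
  }
  have comb: "int_comb ?cs c = int_comb bs (c(k := int m * c k))" for c
    using scale[of "\<lambda>i. of_int (c i)"] by (simp add: fun_upd_def if_distrib[of real_of_int] cong: if_cong)
  show "{int_comb bs c | c. int m dvd c k} = range (int_comb ?cs)"
  proof (intro equalityI subsetI)
    fix x assume "x \<in> {int_comb bs c | c. int m dvd c k}"
    then obtain c t where c: "x = int_comb bs c" "c k = int m * t" by (auto elim!: dvdE)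
    have "(c(k := t))(k := int m * (c(k := t)) k) = c" using c(2) by auto
    then have "x = int_comb ?cs (c(k := t))" unfolding comb c(1) by (simp only:)
    then show "x \<in> range (int_comb ?cs)" by blast
  next
    fix x assume "x \<in> range (int_comb ?cs)"
    then obtain c where "x = int_comb bs (c(k := int m * c k))" unfolding comb by blast
    then show "x \<in> {int_comb bs c | c. int m dvd c k}" by force
  qed
qed

lemma congruence_sublattice_subset:
  assumes "lattice_basis bs L"
  shows "congruence_sublattice bs m a \<subseteq> L"
  unfolding lattice_basis_range[OF assms] congruence_sublattice_def by blast

text \<open>In an adapted basis the congruence reads \<open>m dvd a k * c k\<close> for the last index \<open>k\<close>, and primitivity makes
  \<open>a k\<close> a unit modulo \<open>m\<close>. Hence scaling the last basis vector by \<open>m\<close> gives a basis of the sublattice,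
  and the matrix between the two bases already is in Smith normal form.\<close>

lemma congruence_sublattice_is_cocyclic:
  assumes bs: "lattice_basis bs L" "length bs = n" and "primitive_mod n (int m) a" "n \<ge> 1" "m > 0"
  defines "M \<equiv> congruence_sublattice bs (int m) a"
  shows "sublattice n M L" "has_invariant_factors n M L (replicate (n - 1) 1 @ [m])"
proof -
  obtain bs' a' where b: "lattice_basis bs' L" "length bs' = n" "primitive_mod n (int m) a'"
    "congruence_sublattice bs' (int m) a' = M" "\<And>i. i < n - 1 \<Longrightarrow> a' i = 0"
    using congruence_sublattice_adapted_basis[OF bs assms(3,4)] unfolding M_def by blast
  obtain k where k: "n = Suc k" using \<open>n \<ge> 1\<close> by (cases n) auto
  have dot: "(\<Sum>i<n. a' i * c i) = a' k * c k" for c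
    using b(5) by (simp add: k)
  have "coprime (a' k) (int m)"
    using b(3) unfolding primitive_mod_def dot coprime_iff_invertible_int by blast
  then have "M = {int_comb bs' c | c. int m dvd c k}"
    unfolding b(4)[symmetric] congruence_sublattice_def b(2) dot
    by (simp add: coprime_dvd_mult_right_iff coprime_commute)
  then have cs: "lattice_basis (bs'[k := real m *\<^sub>R bs' ! k]) M" (is "lattice_basis ?cs M")
    using lattice_basis_scale_last[OF b(1)] b(2) k \<open>m > 0\<close> by simp
  show "sublattice n M L"
    unfolding sublattice_def euclidean_lattice_def
  proof (intro conjI exI[of _ ?cs])
    show "M \<subseteq> L" unfolding M_def by (rule congruence_sublattice_subset[OF bs(1)])
  qed (use cs b(2) in simp_all)
  let ?D = "mat n n (\<lambda>(i, j). if i = j then (if i = k then int m else 1) else 0) :: int mat"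
  have ex: "expresses_in_basis ?D ?cs bs'"
    unfolding expresses_in_basis_def
    by (auto simp: b(2) nth_list_update if_distrib[of "\<lambda>t. t *\<^sub>R _"] if_distrib[of real_of_int] cong: if_cong)
  have smith: "smith_normal_form_of n ?D ?D"
    unfolding smith_normal_form_of_def
  proof (intro conjI exI[of _ "1\<^sub>m n"])
    show "invertible_mat (1\<^sub>m n :: int mat)"
      unfolding invertible_mat_def inverts_mat_def by (auto intro!: exI[of _ "1\<^sub>m n"])
    then show "invertible_mat (1\<^sub>m n :: int mat)" .
  qed (auto simp: diagonal_mat_def k)
  have "diag_mat ?D = map int (replicate (n - 1) 1 @ [m])"
    by (rule nth_equalityI) (auto simp: diag_mat_def nth_append k)
  then show "has_invariant_factors n M L (replicate (n - 1) 1 @ [m])"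
    unfolding has_invariant_factors_def using b(1,2) cs ex smith
    by (intro exI[of _ bs'] exI[of _ ?cs] exI[of _ ?D]) simp
qed

text \<open>If \<open>D = P * A * Q\<close> with \<open>P\<close>, \<open>Q\<close> unimodular, then a coordinate vector \<open>v\<close> lies in \<open>A \<int>\<^sup>n\<close> iff \<open>P v\<close> lies in
  \<open>D \<int>\<^sup>n\<close>, which for \<open>D = diag(1, \<dots>, 1, m)\<close> is a congruence on the last coordinate of \<open>P v\<close> alone. So the
  form is the last row of \<open>P\<close>, primitive because \<open>P\<close> is invertible.\<close>

lemma cocyclic_is_congruence_sublattice:
  assumes "n \<ge> 1" "has_invariant_factors n M L (replicate (n - 1) 1 @ [m])"
  obtains bs a where "lattice_basis bs L" "length bs = n" "primitive_mod n (int m) a"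
    "M = congruence_sublattice bs (int m) a"
proof -
  obtain k where k: "n = Suc k" using \<open>n \<ge> 1\<close> by (cases n) auto
  obtain bs cs A D where len: "length bs = n" "length cs = n"
    and bs: "lattice_basis bs L" and cs: "lattice_basis cs M"
    and ex: "expresses_in_basis A cs bs" and smith: "smith_normal_form_of n A D"
    and diag: "diag_mat D = map int (replicate (n - 1) 1 @ [m])"
    using assms(2) unfolding has_invariant_factors_def by blast
  obtain P Q where A: "A \<in> carrier_mat n n" and D: "D \<in> carrier_mat n n" "diagonal_mat D"
    and PQ: "P \<in> carrier_mat n n" "Q \<in> carrier_mat n n" "invertible_mat P" "invertible_mat Q" "D = P * A * Q"
    using smith unfolding smith_normal_form_of_def by blast
  have inv: "\<exists>B. B \<in> carrier_mat n n \<and> X * B = 1\<^sub>m n \<and> B * X = 1\<^sub>m n"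
    if X: "X \<in> carrier_mat n n" "invertible_mat X" for X :: "int mat"
  proof -
    obtain B where B: "X * B = 1\<^sub>m (dim_row X)" "B * X = 1\<^sub>m (dim_row B)"
      using X(2) unfolding invertible_mat_def inverts_mat_def by blast
    have "dim_col B = n" using arg_cong[OF B(1), of dim_col] X(1) by simp
    moreover have "dim_row B = n" using arg_cong[OF B(2), of dim_col] X(1) by simp
    ultimately show ?thesis using B X(1) by (intro exI[of _ B]) auto
  qed
  obtain P' where P': "P' \<in> carrier_mat n n" "P * P' = 1\<^sub>m n" "P' * P = 1\<^sub>m n" using inv PQ by blast
  obtain Q' where Q': "Q' \<in> carrier_mat n n" "Q * Q' = 1\<^sub>m n" "Q' * Q = 1\<^sub>m n" using inv PQ by blast
  have Dii: "D $$ (i, i) = (if i = k then int m else 1)" if "i < n" for i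
  proof -
    have "D $$ (i, i) = diag_mat D ! i" using D(1) that by (simp add: diag_mat_def)
    then show ?thesis using that by (auto simp: diag nth_append k less_Suc_eq)
  qed
  have Dv: "(D *\<^sub>v v) $ i = (if i = k then int m else 1) * v $ i" if "v \<in> carrier_vec n" "i < n" for v i
  proof -
    have "(D *\<^sub>v v) $ i = (\<Sum>j<n. D $$ (i, j) * v $ j)"
      using that D(1) by (simp add: scalar_prod_def atLeast0LessThan)
    also have "\<dots> = (\<Sum>j<n. if j = i then D $$ (i, i) * v $ i else 0)"
      using that D by (intro sum.cong) (auto simp: diagonal_mat_def)
    finally show ?thesis using that by (simp add: Dii)
  qed
  let ?a = "\<lambda>i. P $$ (k, i)"
  have Pv: "(P *\<^sub>v vec n c) $ k = (\<Sum>i<n. ?a i * c i)" for c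
    using PQ(1) by (simp add: scalar_prod_def k atLeast0LessThan)
  have vec_nth: "vec n (\<lambda>i. v $ i) = v" if "v \<in> carrier_vec n" for v :: "int vec"
    using that by (intro eq_vecI) simp_all
  have Mx: "int_comb cs c = int_comb bs (\<lambda>i. (A *\<^sub>v vec n c) $ i)" for c
  proof -
    have "int_comb cs c = (\<Sum>j<n. \<Sum>i<n. of_int (A $$ (i, j) * c j) *\<^sub>R bs ! i)"
      using ex by (simp add: expresses_in_basis_def len scaleR_sum_right mult.commute)
    also have "\<dots> = (\<Sum>i<n. of_int (\<Sum>j<n. A $$ (i, j) * c j) *\<^sub>R bs ! i)"
      by (subst sum.swap) (simp add: scaleR_sum_left)
    also have "\<dots> = int_comb bs (\<lambda>i. (A *\<^sub>v vec n c) $ i)"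
      unfolding len using A by (intro sum.cong refl) (simp add: scalar_prod_def atLeast0LessThan)
    finally show ?thesis .
  qed
  have "primitive_mod n (int m) ?a"
  proof -
    let ?v = "P' *\<^sub>v unit_vec n k"
    have v: "?v \<in> carrier_vec n" using P' by (intro mult_mat_vec_carrier) auto
    have "P *\<^sub>v ?v = unit_vec n k"
      using assoc_mult_mat_vec[OF PQ(1) P'(1), of "unit_vec n k"] P'(2) by simp
    moreover have "vec n (\<lambda>i. ?v $ i) = ?v" using v by (rule vec_nth)
    ultimately have "(\<Sum>i<n. ?a i * ?v $ i) = 1" using Pv[of "\<lambda>i. ?v $ i"] by (simp add: k)
    then show ?thesis unfolding primitive_mod_def by (intro exI[of _ "\<lambda>i. ?v $ i"]) simp
  qed
  moreover have "M = congruence_sublattice bs (int m) ?a"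
  proof (intro equalityI subsetI)
    fix x assume "x \<in> M"
    then obtain c where c: "x = int_comb cs c" unfolding lattice_basis_range[OF cs] by blast
    let ?y = "A *\<^sub>v vec n c" and ?w = "Q' *\<^sub>v vec n c"
    have y: "?y \<in> carrier_vec n" and w: "?w \<in> carrier_vec n" using A Q' by auto
    have "P *\<^sub>v ?y = D *\<^sub>v ?w"
    proof -
      have "Q *\<^sub>v ?w = vec n c" using assoc_mult_mat_vec[OF PQ(2) Q'(1), of "vec n c"] Q'(2) by simp
      then show ?thesis unfolding PQ(5)
        using assoc_mult_mat_vec[of "P * A" n n Q n ?w] assoc_mult_mat_vec[of P n n A n "vec n c"] PQ A w by simp
    qed
    moreover have "vec n (\<lambda>i. ?y $ i) = ?y" using y by (rule vec_nth)
    ultimately have "(\<Sum>i<n. ?a i * ?y $ i) = int m * ?w $ k"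
      using Pv[of "\<lambda>i. ?y $ i"] Dv[OF w, of k] by (simp add: k)
    then show "x \<in> congruence_sublattice bs (int m) ?a"
      unfolding congruence_sublattice_def c Mx by (auto simp: len)
  next
    fix x assume "x \<in> congruence_sublattice bs (int m) ?a"
    then obtain c where c: "x = int_comb bs c" "int m dvd (\<Sum>i<n. ?a i * c i)"
      unfolding congruence_sublattice_def len by blast
    then obtain t where t: "(\<Sum>i<n. ?a i * c i) = int m * t" by (auto elim: dvdE)
    let ?v = "vec n c"
    define w where "w = vec n (\<lambda>i. if i = k then t else (P *\<^sub>v ?v) $ i)"
    have w: "w \<in> carrier_vec n" by (simp add: w_def)
    have Dw: "D *\<^sub>v w = P *\<^sub>v ?v"
    proof (rule eq_vecI)
      fix i assume "i < dim_vec (P *\<^sub>v ?v)"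
      then have i: "i < n" using PQ(1) by simp
      show "(D *\<^sub>v w) $ i = (P *\<^sub>v ?v) $ i"
        unfolding Dv[OF w i] using i t Pv[of c] by (simp add: w_def del: index_mult_mat_vec)
    qed (use D PQ in simp)
    let ?z = "Q *\<^sub>v w"
    have z: "?z \<in> carrier_vec n" using PQ w by auto
    have "P *\<^sub>v (A *\<^sub>v ?z) = P *\<^sub>v ?v"
      using Dw unfolding PQ(5)
      using assoc_mult_mat_vec[of "P * A" n n Q n w] assoc_mult_mat_vec[of P n n A n ?z] PQ A w z by simp
    then have "P' *\<^sub>v (P *\<^sub>v (A *\<^sub>v ?z)) = P' *\<^sub>v (P *\<^sub>v ?v)" by simp
    moreover have "P' *\<^sub>v (P *\<^sub>v u) = u" if "u \<in> carrier_vec n" for u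
      using assoc_mult_mat_vec[OF P'(1) PQ(1) that] P'(3) that by simp
    ultimately have Az: "A *\<^sub>v ?z = ?v" using A z by auto
    have "vec n (\<lambda>i. ?z $ i) = ?z" using z by (rule vec_nth)
    then have "int_comb cs (\<lambda>i. ?z $ i) = x"
      unfolding Mx c(1) using Az by (simp add: len)
    then show "x \<in> M" unfolding lattice_basis_range[OF cs] by blast
  qed
  ultimately show ?thesis using that bs len(1) by blast
qed

lemma congruence_sublattice_cong:
  assumes "\<And>i. i < length bs \<Longrightarrow> [a i = b i] (mod m)"
  shows "congruence_sublattice bs m a = congruence_sublattice bs m b"
proof -
  have "[(\<Sum>i<length bs. a i * c i) = (\<Sum>i<length bs. b i * c i)] (mod m)" for c
    by (intro cong_sum cong_mult assms cong_refl) auto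
  then show ?thesis unfolding congruence_sublattice_def using cong_dvd_iff by blast
qed

lemma cocyclic_sublattices_eq:
  assumes bs: "lattice_basis bs L" "length bs = n" and "n \<ge> 1" "m > 0"
  shows "{M. sublattice n M L \<and> has_invariant_factors n M L (replicate (n - 1) 1 @ [m])} =
    congruence_sublattice bs (int m) ` primitive_vectors n (int m)" (is "?S = ?R")
proof (intro equalityI subsetI)
  fix M assume "M \<in> ?S"
  then obtain bs' a' where b: "lattice_basis bs' L" "length bs' = n" "primitive_mod n (int m) a'"
    and M: "M = congruence_sublattice bs' (int m) a'"
    using cocyclic_is_congruence_sublattice[OF \<open>n \<ge> 1\<close>] by blast
  obtain a where "congruence_sublattice bs (int m) a = congruence_sublattice bs' (int m) a'"
    and a2: "primitive_mod n (int m) a"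
    by (rule congruence_sublattice_any_basis[OF b(1,2) bs b(3)])
  then have a: "M = congruence_sublattice bs (int m) a" unfolding M by (simp only:)
  let ?b = "\<lambda>i\<in>{..<n}. a i mod int m"
  have "primitive_mod n (int m) ?b"
    using a2 primitive_mod_cong[of n ?b a "int m"] by simp
  then have "?b \<in> primitive_vectors n (int m)"
    using \<open>m > 0\<close> by (auto simp: primitive_vectors_def)
  moreover have "M = congruence_sublattice bs (int m) ?b"
    unfolding a by (rule congruence_sublattice_cong) (simp add: bs)
  ultimately show "M \<in> ?R" by blast
next
  fix M assume "M \<in> ?R"
  then show "M \<in> ?S"
    using congruence_sublattice_is_cocyclic[OF bs _ \<open>n \<ge> 1\<close> \<open>m > 0\<close>] by (auto simp: primitive_vectors_def)
qed

section \<open>Counting\<close>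

text \<open>Two primitive forms have the same kernel modulo \<open>m\<close> iff they differ by a unit of \<open>\<int>/m\<int>\<close>, and distinct
  units give distinct multiples because a primitive form takes the value 1. The unit carrying \<open>a\<close> to
  \<open>b\<close> is the value of \<open>b\<close> at a point \<open>c\<close> where \<open>a\<close> is 1.\<close>

lemma card_congruence_sublattice_fibre:
  assumes bs: "lattice_basis bs L" "length bs = n" and "m > 0" and a: "a \<in> primitive_vectors n (int m)"
  shows "card {b \<in> primitive_vectors n (int m).
    congruence_sublattice bs (int m) b = congruence_sublattice bs (int m) a} = totient m"
proof -
  let ?F = "congruence_sublattice bs (int m)" and ?X = "primitive_vectors n (int m)"
  let ?g = "\<lambda>u::nat. (\<lambda>i\<in>{..<n}. (int u * a i) mod int m)"
  obtain c where c: "[(\<Sum>i<n. a i * c i) = 1] (mod int m)"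
    using a unfolding primitive_vectors_def primitive_mod_def by blast
  have g_dot: "[(\<Sum>i<n. ?g u i * d i) = int u * (\<Sum>i<n. a i * d i)] (mod int m)" for u d
  proof -
    have "[(\<Sum>i<n. ?g u i * d i) = (\<Sum>i<n. (int u * a i) * d i)] (mod int m)"
      by (intro cong_sum cong_mult) auto
    then show ?thesis by (simp add: sum_distrib_left mult_ac)
  qed
  have "inj_on ?g (totatives m)"
  proof (rule inj_onI)
    fix u v assume u: "u \<in> totatives m" and v: "v \<in> totatives m" and eq: "?g u = ?g v"
    have "[int u * (\<Sum>i<n. a i * c i) = int v * (\<Sum>i<n. a i * c i)] (mod int m)"
      using cong_trans[OF cong_sym[OF g_dot[of u c, unfolded eq]] g_dot[of v c]] .
    moreover have "[int w * (\<Sum>i<n. a i * c i) = int w] (mod int m)" for w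
      using cong_scalar_left[OF c, of "int w"] by simp
    ultimately have "[int u = int v] (mod int m)" using cong_sym cong_trans by blast
    then have "[u = v] (mod m)" by (simp add: cong_int_iff)
    moreover have "0 < u" "u \<le> m" "0 < v" "v \<le> m" using u v by (auto simp: in_totatives_iff)
    ultimately show "u = v"
      by (cases "u = m"; cases "v = m") (auto simp: cong_def)
  qed
  moreover have "{b \<in> ?X. ?F b = ?F a} = ?g ` totatives m"
  proof (intro equalityI subsetI)
    fix b assume "b \<in> {b \<in> ?X. ?F b = ?F a}"
    then have b: "b \<in> ?X" and eq: "?F b = ?F a" by auto
    let ?u = "\<Sum>i<n. b i * c i"
    have bi: "[b i = ?u * a i] (mod int m)" if i: "i < n" for i
    proof -
      \<comment> \<open>Subtracting \<open>a i\<close> times \<open>c\<close> moves the unit vector \<open>i\<close> into the kernel of \<open>a\<close>, hence of \<open>b\<close>.\<close>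
      let ?d = "\<lambda>j. (if j = i then 1 else 0) - a i * c j"
      have dot: "(\<Sum>j<n. f j * ?d j) = f i - a i * (\<Sum>j<n. f j * c j)" for f :: "nat \<Rightarrow> int"
      proof -
        have "(\<Sum>j<n. f j * ?d j) = (\<Sum>j<n. (if j = i then f j else 0) - a i * (f j * c j))"
          by (intro sum.cong refl) (simp add: algebra_simps)
        also have "\<dots> = f i - a i * (\<Sum>j<n. f j * c j)"
          using i by (simp add: sum_subtractf sum_distrib_left)
        finally show ?thesis .
      qed
      have "[a i - a i * (\<Sum>j<n. a j * c j) = a i - a i * 1] (mod int m)"
        by (intro cong_diff cong_mult c cong_refl)
      then have "int m dvd (\<Sum>j<n. a j * ?d j)" unfolding dot by (simp add: cong_0_iff)
      then have "int_comb bs ?d \<in> ?F a"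
        unfolding int_comb_in_congruence_sublattice_iff[OF bs(1)] unfolding bs(2) .
      then have "int_comb bs ?d \<in> ?F b" by (simp only: eq)
      then have "int m dvd (\<Sum>j<n. b j * ?d j)"
        unfolding int_comb_in_congruence_sublattice_iff[OF bs(1)] unfolding bs(2) .
      then show ?thesis unfolding dot by (simp add: cong_iff_dvd_diff mult.commute)
    qed
    have "coprime ?u (int m)"
    proof -
      obtain d where d: "[(\<Sum>i<n. b i * d i) = 1] (mod int m)"
        using b unfolding primitive_vectors_def primitive_mod_def by blast
      have "[(\<Sum>i<n. b i * d i) = (\<Sum>i<n. (?u * a i) * d i)] (mod int m)"
        by (intro cong_sum cong_mult bi cong_refl) auto
      moreover have "(\<Sum>i<n. (?u * a i) * d i) = ?u * (\<Sum>i<n. a i * d i)"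
        by (simp only: sum_distrib_left mult.assoc)
      ultimately have "[?u * (\<Sum>i<n. a i * d i) = 1] (mod int m)"
        using cong_trans[OF cong_sym d] by (simp only:)
      then show ?thesis unfolding coprime_iff_invertible_int by blast
    qed
    \<comment> \<open>Totatives lie in \<open>{0<..m}\<close>, so the residue 0 (a unit only for \<open>m = 1\<close>) is represented by \<open>m\<close>.\<close>
    define v where "v = (if ?u mod int m = 0 then m else nat (?u mod int m))"
    have v: "[int v = ?u] (mod int m)" using \<open>m > 0\<close> by (simp add: v_def cong_def)
    have "v \<in> totatives m"
    proof -
      have "coprime (int v) (int m)" using cong_imp_coprime[OF cong_sym[OF v]] \<open>coprime ?u (int m)\<close> by blast
      moreover have "0 < (if w = 0 then m else nat w) \<and> (if w = 0 then m else nat w) \<le> m"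
        if "0 \<le> w" "w < int m" for w using that \<open>m > 0\<close> by auto
      from this[of "?u mod int m"] have "0 < v \<and> v \<le> m" using \<open>m > 0\<close> by (simp add: v_def)
      ultimately show ?thesis by (simp add: in_totatives_iff)
    qed
    moreover have "b = ?g v"
    proof (rule PiE_ext)
      show "b \<in> {..<n} \<rightarrow>\<^sub>E {0..<int m}" using b by (simp add: primitive_vectors_def)
      show "?g v \<in> {..<n} \<rightarrow>\<^sub>E {0..<int m}" using \<open>m > 0\<close> by auto
      fix i assume i: "i \<in> {..<n}"
      have "[b i = int v * a i] (mod int m)"
        using bi[of i] i cong_scalar_right[OF v, of "a i"] by (meson cong_sym cong_trans lessThan_iff)
      moreover have "b i \<in> {0..<int m}" using b i unfolding primitive_vectors_def by blast
      ultimately show "b i = ?g v i" using i by (simp add: cong_def)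
    qed
    ultimately show "b \<in> ?g ` totatives m" by blast
  next
    fix b assume "b \<in> ?g ` totatives m"
    then obtain u where u: "coprime u m" and b: "b = ?g u" by (auto simp: in_totatives_iff)
    have cop: "coprime (int u) (int m)" using u by simp
    then obtain v where v: "[int u * v = 1] (mod int m)" unfolding coprime_iff_invertible_int by blast
    have "[(\<Sum>i<n. b i * (v * c i)) = int u * (\<Sum>i<n. a i * (v * c i))] (mod int m)"
      unfolding b by (rule g_dot)
    moreover have "int u * (\<Sum>i<n. a i * (v * c i)) = (int u * v) * (\<Sum>i<n. a i * c i)"
      by (simp add: sum_distrib_left mult_ac)
    moreover have "[(int u * v) * (\<Sum>i<n. a i * c i) = 1] (mod int m)"
      using cong_mult[OF v c] by simp
    ultimately have "[(\<Sum>i<n. b i * (v * c i)) = 1] (mod int m)" by (simp only: cong_trans)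
    then have "primitive_mod n (int m) b"
      unfolding primitive_mod_def by (intro exI[of _ "\<lambda>i. v * c i"])
    moreover have "b \<in> {..<n} \<rightarrow>\<^sub>E {0..<int m}" unfolding b using \<open>m > 0\<close> by auto
    ultimately have "b \<in> ?X" unfolding primitive_vectors_def by blast
    moreover have "int m dvd (\<Sum>i<n. b i * d i) \<longleftrightarrow> int m dvd (\<Sum>i<n. a i * d i)" for d
      using cong_dvd_iff[OF g_dot[of u d]] cop
      by (simp add: b coprime_dvd_mult_right_iff coprime_commute)
    then have "?F b = ?F a" by (simp add: congruence_sublattice_def bs(2))
    ultimately show "b \<in> {b \<in> ?X. ?F b = ?F a}" by blast
  qed
  ultimately show ?thesis by (simp add: card_image totient_def)
qed

lemma sublattice_count_cocyclic:
  assumes "euclidean_lattice n L" "n \<ge> 1" "m > 0"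
  shows "totient m * sublattice_count L (replicate (n - 1) 1 @ [m]) = jordan_totient n m"
proof -
  obtain bs where bs: "lattice_basis bs L" "length bs = n"
    using assms(1) unfolding euclidean_lattice_def by blast
  let ?F = "congruence_sublattice bs (int m)" and ?X = "primitive_vectors n (int m)"
  have "jordan_totient n m = (\<Sum>M\<in>?F ` ?X. card {b \<in> ?X. ?F b = M})"
    using sum.image_gen[of ?X "\<lambda>_. 1::nat" ?F] by (simp add: jordan_totient_def)
  also have "\<dots> = (\<Sum>M\<in>?F ` ?X. totient m)"
    using card_congruence_sublattice_fibre[OF bs assms(3)] by (intro sum.cong) auto
  also have "\<dots> = totient m * card (?F ` ?X)" by simp
  also have "card (?F ` ?X) = sublattice_count L (replicate (n - 1) 1 @ [m])"
    unfolding sublattice_count_def using cocyclic_sublattices_eq[OF bs assms(2,3)] assms(2) by simp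
  finally show ?thesis by simp
qed

theorem corollary5p2:
  fixes L :: "'a::euclidean_space set" and n m l :: nat and p r :: "nat \<Rightarrow> nat"
  assumes "n \<ge> 1"
    and "euclidean_lattice n L"
    and "inj_on p {1..l}"
    and "\<And>k. k \<in> {1..l} \<Longrightarrow> prime (p k)"
    and "\<And>k. k \<in> {1..l} \<Longrightarrow> r k > 0"
    and "m = (\<Prod>k=1..l. p k ^ r k)"
  shows "real (sublattice_count L (replicate (n - 1) 1 @ [m])) =
    (real m / real (\<Prod>k=1..l. p k)) ^ (n - 1) *
      real (divisor_sum ((\<Prod>k=1..l. p k) ^ (n - 1)))"
proof -
  have pos: "p k > 0" if "k \<in> {1..l}" for k using assms(4)[OF that] by (rule prime_gt_0_nat)
  have m: "m > 0" unfolding assms(6) using pos by (auto intro!: prod_pos)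
  have rad: "(\<Prod>k=1..l. p k) > 0" using pos by (auto intro!: prod_pos)
  have "m = (\<Prod>k=1..l. p k ^ (r k - 1)) * (\<Prod>k=1..l. p k)"
    unfolding assms(6) prod.distrib[symmetric]
    using assms(5) by (intro prod.cong refl power_minus_mult[symmetric])
  then have "real m = real (\<Prod>k=1..l. p k ^ (r k - 1)) * real (\<Prod>k=1..l. p k)"
    by (simp only: of_nat_mult)
  with rad have quot: "real m / real (\<Prod>k=1..l. p k) = real (\<Prod>k=1..l. p k ^ (r k - 1))"
    by (simp only: nonzero_mult_div_cancel_right of_nat_eq_0_iff neq0_conv)
  have "totient m * sublattice_count L (replicate (n - 1) 1 @ [m]) =
      totient m * ((\<Prod>k=1..l. p k ^ (r k - 1)) ^ (n - 1) * divisor_sum ((\<Prod>k=1..l. p k) ^ (n - 1)))"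
    unfolding sublattice_count_cocyclic[OF assms(2,1) m] unfolding assms(6)
    using assms by (intro jordan_totient_eq) auto
  then have "sublattice_count L (replicate (n - 1) 1 @ [m]) =
      (\<Prod>k=1..l. p k ^ (r k - 1)) ^ (n - 1) * divisor_sum ((\<Prod>k=1..l. p k) ^ (n - 1))"
    using m by simp
  then show ?thesis unfolding quot by simp
qed

end
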